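(* Let $k$ be an algebraically closed field of characteristic $0$. Let $\gamma,h$ be natural numbers with $h\ge 1$, let $\vec s=(s_1,\ldots,s_h)$ be a sequence of natural numbers (possibly zero), and let $\vec a=(a_1,\ldots,a_h)$ be a sequence of distinct elements of $k$. Let $R=\sum_{\ell=1}^h s_\ell+h$ and assume $R\le\gamma+1$. Let $M$ be the enriched Vandermonde matrix associated to $(\gamma+1,\vec s,\vec a)$, which has $R$ rows and $\gamma+1$ columns. Then $M$ has rank $R$.
   Context: Define $r_1=1$ and $r_{\ell+1}=r_\ell+s_\ell+1$ for $1\le\ell<h$. The enriched Vandermonde matrix associated to $(\gamma+1,\vec s,\vec a)$ is the matrix $M$ with $R$ rows and $\gamma+1$ columns whose entry on the $i$-th row and $j$-th column is $M[i,j]=\frac{d^s}{da_\ell^s}a_\ell^{j-1}$, i.e. the $s$-th formal derivative of the polynomial $X^{j-1}$ evaluated at $X=a_\ell$, where $\ell\in\{1,\ldots,h\}$ and $s$ are the unique numbers with $i=r_\ell+s$ and $0\le s\le s_\ell$. (So $M$ consists of $h$ blocks of rows, the $\ell$-th block having $s_\ell+1$ rows containing the derivatives of orders $0,\ldots,s_\ell$ of $1,X,X^2,\ldots,X^\gamma$ at $a_\ell$.) *)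

theory Defs
  imports "Jordan_Normal_Form.DL_Rank"
begin

(* All indices (blocks, rows, columns) start at 0 instead of 1: the sequences
   s_1, ..., s_h and a_1, ..., a_h become the values of functions on {..<h}, row i stands
   for the (i+1)-st row, and block_start s l is r_(l+1) - 1. *)

primrec block_start :: "(nat \<Rightarrow> nat) \<Rightarrow> nat \<Rightarrow> nat" where
  "block_start s 0 = 0"
| "block_start s (Suc l) = block_start s l + s l + 1"

definition block_pos :: "nat \<Rightarrow> (nat \<Rightarrow> nat) \<Rightarrow> nat \<Rightarrow> nat \<times> nat" where
  "block_pos h s i = (THE (l, t). l < h \<and> t \<le> s l \<and> i = block_start s l + t)"

definition enriched_vandermonde ::
    "nat \<Rightarrow> nat \<Rightarrow> (nat \<Rightarrow> nat) \<Rightarrow> (nat \<Rightarrow> 'a) \<Rightarrow> 'a :: field_char_0 mat" where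
  "enriched_vandermonde n h s a =
     mat ((\<Sum>l<h. s l) + h) n
       (\<lambda>(i, j). case block_pos h s i of (l, t) \<Rightarrow> poly ((pderiv ^^ t) (monom 1 j)) (a l))"

lemma block_start_eq: "block_start s l = (\<Sum>m<l. s m) + l"
  by (induction l) auto

lemma block_start_less:
  assumes "l < m"
  shows "block_start s l + s l < block_start s m"
  using assms by (induction m) (auto simp: less_Suc_eq)

(* Every row lies in exactly one block, so the description in block_pos is meaningful. *)
lemma block_pos_ex:
  assumes "i < (\<Sum>l<h. s l) + h"
  shows "\<exists>l t. l < h \<and> t \<le> s l \<and> i = block_start s l + t"
  using assms
proof (induction h)
  case (Suc h)
  show ?case
  proof (cases "i < (\<Sum>l<h. s l) + h")
    case True
    then show ?thesis using Suc.IH less_Suc_eq by blast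
  next
    case False
    then have "i = block_start s h + (i - block_start s h)" "i - block_start s h \<le> s h"
      using Suc.prems by (auto simp: block_start_eq)
    then show ?thesis by blast
  qed
qed simp

lemma block_pos_unique:
  assumes "t \<le> s l" "t' \<le> s l'" "block_start s l + t = block_start s l' + t'"
  shows "l = l' \<and> t = t'"
  using assms block_start_less[of l l' s] block_start_less[of l' l s]
  by (cases l l' rule: linorder_cases) auto

lemma block_pos_eq:
  assumes "l < h" "t \<le> s l"
  shows "block_pos h s (block_start s l + t) = (l, t)"
  unfolding block_pos_def using assms
  by (intro the_equality) (auto dest: block_pos_unique)

end

theory Submission
  imports Defs
begin

text \<open>
  The matrix is the matrix of Hermite interpolation: applied to the coefficient vector of a
  polynomial \<open>p\<close> it returns the values at every \<open>a l\<close> of the derivatives of \<open>p\<close> of orders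
  \<open>0, \<dots>, s l\<close>. In characteristic 0 all these values vanish only if every \<open>a l\<close> is a root of
  \<open>p\<close> of multiplicity at least \<open>s l + 1\<close> (\<open>higher_pderivs_vanish_imp_less_order\<close>). Such a
  polynomial has at least \<open>R\<close> roots counted with multiplicity, because the \<open>a l\<close> are distinct,
  so it is zero as soon as its degree is below \<open>R\<close> (\<open>hermite_data_vanish_imp_zero\<close>).

  The first \<open>R\<close> columns of the matrix describe the polynomials of degree below \<open>R\<close>. The square
  matrix that they form thus has trivial kernel and nonzero determinant
  (\<open>det_square_enriched_vandermonde_nonzero\<close>), and its columns are \<open>R\<close> linearly independent
  columns of the whole matrix. As there are only \<open>R\<close> rows, the rank is exactly \<open>R\<close>.
\<close>

text \<open>
  In characteristic 0, differentiation lowers the multiplicity of a root by exactly one, so each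
  further derivative that vanishes at \<open>x\<close> adds one to the multiplicity of \<open>x\<close> in \<open>p\<close>.
\<close>

lemma higher_pderivs_vanish_imp_less_order:
  fixes p :: "'a :: field_char_0 poly"
  assumes "p \<noteq> 0" and "\<And>t. t \<le> m \<Longrightarrow> poly ((pderiv ^^ t) p) x = 0"
  shows "m < order x p"
  using assms
proof (induction m arbitrary: p)
  case 0
  then have "poly p x = 0" by force
  with 0 show ?case by (simp add: order_gt_0_iff)
next
  case (Suc m)
  have root: "poly p x = 0" using Suc.prems(2)[of 0] by simp
  have "pderiv p \<noteq> 0"
  proof
    assume "pderiv p = 0"
    then obtain c where "p = [:c:]" by (metis degree_eq_zeroE pderiv_eq_0_iff)
    with root Suc.prems(1) show False by simp
  qed
  moreover have "poly ((pderiv ^^ t) (pderiv p)) x = 0" if "t \<le> m" for t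
    using Suc.prems(2)[of "Suc t"] that by (simp add: funpow_Suc_right del: funpow.simps)
  ultimately have "m < order x (pderiv p)" by (rule Suc.IH)
  with order_pderiv[OF Suc.prems(1) root] show ?case by simp
qed

text \<open>
  The uniqueness half of Hermite interpolation: the data force more roots, counted with
  multiplicity, than the degree of a nonzero polynomial permits.
\<close>

lemma hermite_data_vanish_imp_zero:
  fixes p :: "'a :: field_char_0 poly"
  assumes "finite I" and "inj_on a I"
    and vanish: "\<And>i t. i \<in> I \<Longrightarrow> t \<le> s i \<Longrightarrow> poly ((pderiv ^^ t) p) (a i) = 0"
    and deg: "degree p < (\<Sum>i\<in>I. Suc (s i))"
  shows "p = 0"
proof (rule ccontr)
  assume "p \<noteq> 0"
  have "(\<Sum>i\<in>I. Suc (s i)) \<le> (\<Sum>i\<in>I. order (a i) p)"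
    using higher_pderivs_vanish_imp_less_order[OF \<open>p \<noteq> 0\<close> vanish]
    by (intro sum_mono) (simp add: Suc_le_eq)
  also have "\<dots> = (\<Sum>x\<in>a ` I. order x p)"
    using \<open>inj_on a I\<close> by (simp add: sum.reindex)
  also have "\<dots> \<le> (\<Sum>x | poly p x = 0. order x p)"
  proof (rule sum_mono2)
    show "finite {x. poly p x = 0}" using \<open>p \<noteq> 0\<close> by (rule poly_roots_finite)
    show "a ` I \<subseteq> {x. poly p x = 0}" using vanish[of _ 0] by auto
  qed simp
  also have "\<dots> \<le> degree p" using \<open>p \<noteq> 0\<close> by (rule sum_order_le_degree)
  finally show False using deg by simp
qed

lemma dim_enriched_vandermonde [simp]:
  "dim_row (enriched_vandermonde n h s a) = (\<Sum>l<h. s l) + h"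
  "dim_col (enriched_vandermonde n h s a) = n"
  by (simp_all add: enriched_vandermonde_def)

lemma enriched_vandermonde_carrier:
  "R = (\<Sum>l<h. s l) + h \<Longrightarrow> enriched_vandermonde n h s a \<in> carrier_mat R n"
  by (rule carrier_matI) simp_all

lemma block_row_less:
  assumes "l < h" "t \<le> s l"
  shows "block_start s l + t < (\<Sum>m<h. s m) + h"
proof -
  have "block_start s (Suc l) \<le> block_start s h"
    using \<open>l < h\<close> block_start_less[of "Suc l" h s] by (cases "Suc l = h") auto
  with \<open>t \<le> s l\<close> show ?thesis by (simp add: block_start_eq)
qed

lemma enriched_vandermonde_index:
  assumes "l < h" "t \<le> s l" "j < n"
  shows "enriched_vandermonde n h s a $$ (block_start s l + t, j) =
    poly ((pderiv ^^ t) (monom 1 j)) (a l)"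
  using assms by (simp add: enriched_vandermonde_def block_row_less block_pos_eq)

text \<open>
  Multiplication by the matrix evaluates derivatives of the polynomial with the given
  coefficients, which turns questions about its kernel into questions about roots.
\<close>

lemma enriched_vandermonde_mult_vec:
  assumes "l < h" "t \<le> s l" "v \<in> carrier_vec n"
  shows "(enriched_vandermonde n h s a *\<^sub>v v) $ (block_start s l + t) =
    poly ((pderiv ^^ t) (\<Sum>j<n. monom (v $ j) j)) (a l)"
proof -
  have "(enriched_vandermonde n h s a *\<^sub>v v) $ (block_start s l + t) =
      (\<Sum>j<n. enriched_vandermonde n h s a $$ (block_start s l + t, j) * v $ j)"
    using assms block_row_less[of l h t s]
    by (simp add: scalar_prod_def atLeast0LessThan)
  also have "\<dots> = (\<Sum>j<n. poly ((pderiv ^^ t) (monom 1 j)) (a l) * v $ j)"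
    using assms by (simp add: enriched_vandermonde_index)
  also have "\<dots> = (\<Sum>j<n. poly ((pderiv ^^ t) (Polynomial.smult (v $ j) (monom 1 j))) (a l))"
    by (intro sum.cong refl) (simp only: higher_pderiv_smult poly_smult mult.commute)
  also have "\<dots> = poly ((pderiv ^^ t) (\<Sum>j<n. monom (v $ j) j)) (a l)"
    by (simp add: higher_pderiv_sum poly_sum Polynomial.smult_monom)
  finally show ?thesis .
qed

lemma det_square_enriched_vandermonde_nonzero:
  fixes a :: "nat \<Rightarrow> 'a :: field_char_0"
  assumes inj: "inj_on a {..<h}" and R: "R = (\<Sum>l<h. s l) + h"
  shows "det (enriched_vandermonde R h s a) \<noteq> 0"
proof
  let ?B = "enriched_vandermonde R h s a"
  assume "det ?B = 0"
  with det_0_iff_vec_prod_zero[OF enriched_vandermonde_carrier[OF R, of R a]]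
  obtain v where v: "v \<in> carrier_vec R" "v \<noteq> 0\<^sub>v R" "?B *\<^sub>v v = 0\<^sub>v R" by blast
  define p where "p = (\<Sum>j<R. monom (v $ j) j)"
  have coeff_p: "coeff p j = (if j < R then v $ j else 0)" for j
    by (simp add: p_def coeff_sum coeff_monom sum.delta)
  \<comment> \<open>For \<open>R = 0\<close> the empty sum is zero, but its degree 0 is not below \<open>R\<close>.\<close>
  have "p = 0"
  proof (cases "R = 0")
    case False
    show ?thesis
    proof (rule hermite_data_vanish_imp_zero)
      show "poly ((pderiv ^^ t) p) (a l) = 0" if "l \<in> {..<h}" "t \<le> s l" for l t
        using enriched_vandermonde_mult_vec[of l h t s v R a] block_row_less[of l h t s] that v R
        by (simp add: p_def del: index_mult_mat_vec)
      have "degree p \<le> R - 1" by (rule degree_le) (use coeff_p in auto)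
      then have "degree p < R" using False by simp
      also have "R = (\<Sum>l<h. Suc (s l))" using R by (simp add: sum_Suc)
      finally show "degree p < (\<Sum>l<h. Suc (s l))" .
    qed (use inj in auto)
  qed (simp add: p_def)
  then have "v = 0\<^sub>v R" using coeff_p v(1) by (intro eq_vecI) (auto split: if_splits, metis coeff_0)
  with v(2) show False by simp
qed

lemma (in vec_space) rank_le_dim_row:
  assumes "A \<in> carrier_mat n nc"
  shows "rank A \<le> n"
proof -
  obtain S where S: "maximal S (\<lambda>T. T \<subseteq> set (cols A) \<and> lin_indpt T)"
    using maximal_exists_superset[of "set (cols A)" "\<lambda>T. T \<subseteq> set (cols A) \<and> lin_indpt T" "{}"]
      finite_lin_indpt2[of "{}"] by auto
  then have "S \<subseteq> carrier_vec n" "lin_indpt S"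
    using cols_dim[of A] assms by (auto simp: maximal_def)
  then have "card S \<le> n" using li_le_dim(2)[OF fin_dim] dim_is_n by simp
  with rank_card_indpt[OF assms S] show ?thesis by simp
qed

lemma (in vec_space) rank_full_if_invertible_columns:
  assumes A: "A \<in> carrier_mat n nc" and B: "B \<in> carrier_mat n n"
    and sub: "set (cols B) \<subseteq> set (cols A)" and det: "det B \<noteq> 0"
  shows "rank A = n"
proof (rule antisym)
  have rank_B: "rank B = n" using B det by (simp add: det_rank_iff)
  then have dist: "distinct (cols B)" using non_distinct_low_rank[OF B] by force
  have "card (set (cols B)) \<le> rank A"
    using A sub full_rank_lin_indpt[OF B rank_B dist] by (rule rank_ge_card_indpt)
  then show "n \<le> rank A" using B distinct_card[OF dist] by simp
qed (rule rank_le_dim_row[OF A])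

lemma cols_enriched_vandermonde_subset:
  assumes "m \<le> n"
  shows "set (cols (enriched_vandermonde m h s a)) \<subseteq> set (cols (enriched_vandermonde n h s a))"
proof
  fix c assume "c \<in> set (cols (enriched_vandermonde m h s a))"
  then obtain j where j: "j < m" "c = col (enriched_vandermonde m h s a) j"
    by (auto simp: cols_def)
  then have "c = col (enriched_vandermonde n h s a) j"
    using assms by (auto simp: enriched_vandermonde_def)
  with j(1) assms show "c \<in> set (cols (enriched_vandermonde n h s a))"
    by (auto simp: cols_def)
qed

theorem theorem53:
  fixes \<gamma> h R :: nat
    and s :: "nat \<Rightarrow> nat"
    and a :: "nat \<Rightarrow> 'k :: {alg_closed_field, field_char_0}"
  assumes "h \<ge> 1"
    and "inj_on a {..<h}"
    and "R = (\<Sum>l<h. s l) + h"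
    and "R \<le> \<gamma> + 1"
  shows "vec_space.rank R (enriched_vandermonde (\<gamma> + 1) h s a) = R"
proof (rule vec_space.rank_full_if_invertible_columns)
  show "enriched_vandermonde (\<gamma> + 1) h s a \<in> carrier_mat R (\<gamma> + 1)"
    "enriched_vandermonde R h s a \<in> carrier_mat R R"
    using assms(3) by (rule enriched_vandermonde_carrier)+
  show "det (enriched_vandermonde R h s a) \<noteq> 0"
    using assms(2,3) by (rule det_square_enriched_vandermonde_nonzero)
qed (rule cols_enriched_vandermonde_subset[OF assms(4)])

end
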